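(* For every $n\ge1$, the procedure $p\mapsto T(p)$ is a bijection from the set of 213-avoiding permutations of $\{1,\dots,n\}$ to the set of binary trees with $n+1$ leaves.
   Context: A permutation $p=(m_1,\dots,m_n)$ of $\{1,\dots,n\}$ is 213-avoiding if there are no indices $i<j<k$ with $m_j<m_i<m_k$. A binary tree is a finite planar rooted tree in which every internal node has exactly two children (a left child and a right child). Procedure. Given a finite sequence $p=(\phi_1,\dots,\phi_n)$ of distinct integers (213-avoiding), define the binary tree $T(p)$ with $n+1$ leaves recursively. If $p$ is empty, $T(p)$ is a single leaf. Otherwise let $\phi_a$ be the smallest term of $p$, let $y=(\phi_1,\dots,\phi_{a-1})$ be the sequence of terms before it and $x=(\phi_{a+1},\dots,\phi_n)$ the sequence of terms after it; then $T(p)$ is the tree whose root has left subtree $T(x)$ (with $|x|+1$ leaves) and right subtree $T(y)$ (with $|y|+1$ leaves). (In a picture with root at $(0,0)$ and leaves at $(n,0),(n-1,1),\dots,(0,n)$ from left to right, one draws the ascending line from $(n,0)$ to $(0,0)$, the descending line from $(0,0)$ to $(0,n)$, the ascending line from $(|y|,n-|y|)$ to $(0,n-|y|)$ and the descending line from $(n-|x|,0)$ to $(n-|x|,|x|)$, and repeats in the two subtrees.) *)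

theory Defs
  imports "HOL-Library.Tree" "HOL-Combinatorics.Multiset_Permutations"
begin

text \<open>
  Permutations of \<open>{1..n}\<close> are lists in one-line notation. Binary trees are \<^typ>\<open>unit tree\<close>:
  the internal nodes carry no information, and \<^const>\<open>size1\<close> counts the leaves.
\<close>

definition avoids_213 :: "'a::linorder list \<Rightarrow> bool" where
  "avoids_213 p \<longleftrightarrow>
    \<not> (\<exists>i j k. i < j \<and> j < k \<and> k < length p \<and> p ! j < p ! i \<and> p ! i < p ! k)"

text \<open>
  The terms before the minimum form the right subtree, those after it the left subtree.
  The function is total on lists; only lists of distinct elements are of interest.
\<close>

function tree_of_seq :: "'a::linorder list \<Rightarrow> unit tree" where
  "tree_of_seq p =
    (if p = [] then \<langle>\<rangle>
     else let m = Min (set p);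
              y = takeWhile (\<lambda>a. a \<noteq> m) p;
              x = tl (dropWhile (\<lambda>a. a \<noteq> m) p)
          in \<langle>tree_of_seq x, (), tree_of_seq y\<rangle>)"
  by auto

lemma length_tl_dropWhile_less:
  assumes "p \<noteq> []"
  shows "length (tl (dropWhile P p)) < length p"
proof -
  have "length (tl (dropWhile P p)) \<le> length (tl p)"
    unfolding length_tl using length_dropWhile_le diff_le_mono by blast
  also have "\<dots> < length p"
    using assms by simp
  finally show ?thesis .
qed

lemma length_takeWhile_less_mem: "m \<in> set p \<Longrightarrow> length (takeWhile (\<lambda>a. a \<noteq> m) p) < length p"
  by (induction p) auto

termination
  by (relation "measure length")
    (auto simp del: length_tl intro!: length_takeWhile_less_mem length_tl_dropWhile_less)

declare tree_of_seq.simps [simp del]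

end

theory Submission
  imports Defs
begin

text \<open>
  Write \<open>p = y @ m # x\<close> with \<open>m\<close> the minimum. A 213-pattern whose middle term is \<open>m\<close> is a term
  of \<open>y\<close> below a term of \<open>x\<close>, so \<open>p\<close> avoids 213 iff \<open>x\<close> and \<open>y\<close> do and all terms of \<open>x\<close> lie
  below all terms of \<open>y\<close>. Hence the lengths of \<open>x\<close> and \<open>y\<close> determine which values occur in each,
  and the tree can be decoded recursively.
\<close>

text \<open>The decoder. \<open>a\<close> is the least value available; \<open>l\<close> encodes the
  terms after the minimum, which avoidance forces to be the smaller ones, so it takes the next
  \<open>size l\<close> values and \<open>r\<close> starts above them.\<close>

fun seq_of_tree :: "nat \<Rightarrow> unit tree \<Rightarrow> nat list" where
  "seq_of_tree a \<langle>\<rangle> = []"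
| "seq_of_tree a \<langle>l, _, r\<rangle> = seq_of_tree (Suc a + size l) r @ a # seq_of_tree (Suc a) l"

lemma tree_of_seq_Nil [simp]: "tree_of_seq [] = \<langle>\<rangle>"
  by (simp add: tree_of_seq.simps)

text \<open>Replaces the search for the minimum by a given splitting. Strictness makes
  \<open>m\<close> occur only at the displayed place, so the scan stops exactly there.\<close>

lemma tree_of_seq_append_Min_Cons:
  assumes "\<forall>z \<in> set y \<union> set x. m < z"
  shows "tree_of_seq (y @ m # x) = \<langle>tree_of_seq x, (), tree_of_seq y\<rangle>"
proof -
  have "Min (set (y @ m # x)) = m"
    using assms by (intro Min_eqI) (auto intro: less_imp_le)
  moreover have "takeWhile (\<lambda>a. a \<noteq> m) (y @ m # x) = y"
    "dropWhile (\<lambda>a. a \<noteq> m) (y @ m # x) = m # x"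
    using assms by (subst takeWhile_append2 dropWhile_append2; auto)+
  ultimately show ?thesis
    by (subst tree_of_seq.simps) (simp add: Let_def)
qed

lemma avoids_213_Nil [simp]: "avoids_213 []"
  by (simp add: avoids_213_def)

lemma avoids_213D:
  assumes "avoids_213 p" "i < j" "j < k" "k < length p" "p ! j < p ! i" "p ! i < p ! k"
  shows False
  using assms unfolding avoids_213_def by blast

lemma avoids_213_appendD:
  assumes "avoids_213 (p @ q)"
  shows "avoids_213 p" "avoids_213 q"
proof -
  show "avoids_213 p"
    unfolding avoids_213_def
  proof safe
    fix i j k assume "i < j" "j < k" "k < length p" "p ! j < p ! i" "p ! i < p ! k"
    then show False
      using avoids_213D[OF assms, of i j k] by (simp add: nth_append)
  qed
  show "avoids_213 q"
    unfolding avoids_213_def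
  proof safe
    fix i j k assume "i < j" "j < k" "k < length q" "q ! j < q ! i" "q ! i < q ! k"
    then show False
      using avoids_213D[OF assms, of "length p + i" "length p + j" "length p + k"] by simp
  qed
qed

lemma avoids_213_append_Min_Cons:
  assumes min: "\<forall>z \<in> set y \<union> set x. m < z" and dist: "distinct (y @ m # x)"
  shows "avoids_213 (y @ m # x) \<longleftrightarrow>
    avoids_213 y \<and> avoids_213 x \<and> (\<forall>b \<in> set x. \<forall>a \<in> set y. b < a)"
proof
  assume av: "avoids_213 (y @ m # x)"
  have "b < a" if "b \<in> set x" "a \<in> set y" for a b
  proof (rule ccontr)
    assume "\<not> b < a"
    moreover have "a \<noteq> b" using dist that by auto
    ultimately have "a < b" by simp
    obtain i where i: "i < length y" "y ! i = a"
      using \<open>a \<in> set y\<close> by (auto simp: in_set_conv_nth)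
    obtain k where k: "k < length x" "x ! k = b"
      using \<open>b \<in> set x\<close> by (auto simp: in_set_conv_nth)
    show False
      \<comment> \<open>The terms \<open>a\<close>, \<open>m\<close>, \<open>b\<close> form a
        213-pattern, with \<open>m\<close> at position \<open>length y\<close>.\<close>
      using avoids_213D[OF av, of i "length y" "length y + Suc k"] i k \<open>a < b\<close> min that
      by (simp add: nth_append)
  qed
  moreover have "avoids_213 x"
    using avoids_213_appendD(2)[of "y @ [m]" x] av by simp
  ultimately show "avoids_213 y \<and> avoids_213 x \<and> (\<forall>b \<in> set x. \<forall>a \<in> set y. b < a)"
    using avoids_213_appendD(1)[OF av] by blast
next
  assume asm: "avoids_213 y \<and> avoids_213 x \<and> (\<forall>b \<in> set x. \<forall>a \<in> set y. b < a)"
  let ?p = "y @ m # x"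
  show "avoids_213 ?p"
    unfolding avoids_213_def
  proof safe
    fix i j k
    assume ijk: "i < j" "j < k" "k < length ?p" "?p ! j < ?p ! i" "?p ! i < ?p ! k"
    \<comment> \<open>The pattern lies inside \<open>y\<close>, or its largest term is not in
      \<open>y\<close> and hence below its first term, or it starts at \<open>m\<close> and nothing
      is smaller, or it lies inside \<open>x\<close>.\<close>
    consider "k < length y" | "i < length y" "length y \<le> k" | "i = length y" | "length y < i"
      by linarith
    then show False
    proof cases
      case 1
      then show False
        using avoids_213D[of y i j k] asm ijk by (simp add: nth_append)
    next
      case 2
      then have "?p ! k \<in> set (m # x)" "?p ! i \<in> set y"
        using ijk(3) nth_mem[of "k - length y" "m # x"] by (auto simp: nth_append)
      then show False
        using asm min ijk(5) by (metis UnI1 less_asym set_ConsD)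
    next
      case 3
      have "?p ! j \<in> set ?p" using ijk by (intro nth_mem) simp
      then show False
        using 3 min ijk(4) by (auto simp: ball_Un dest: less_asym)
    next
      case 4
      define s where "s = Suc (length y)"
      obtain i' j' k' where "i = s + i'" "j = s + j'" "k = s + k'"
        using 4 ijk(1,2) unfolding s_def
        by (metis Suc_leI less_imp_le_nat le_Suc_ex less_trans)
      then show False
        using avoids_213D[of x i' j' k'] asm ijk by (simp add: s_def nth_append)
    qed
  qed
qed

text \<open>\<open>S\<close> is an initial segment of the interval, since no element of
  \<open>T\<close> can lie below one of \<open>S\<close>; its cardinality then fixes where it
  ends.\<close>

lemma Un_eq_atLeastLessThan_separated:
  fixes S T :: "nat set"
  assumes un: "S \<union> T = {b..<b + s + t}" and sep: "\<forall>x \<in> S. \<forall>y \<in> T. x < y" and card: "card S = s"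
  shows "S = {b..<b + s}" "T = {b + s..<b + s + t}"
proof -
  have fin: "finite S" using un by (metis finite_Un finite_atLeastLessThan)
  have "z < b + s" if "z \<in> S" for z
  proof -
    have "{b..z} \<subseteq> S"
    proof
      fix w assume "w \<in> {b..z}"
      moreover have "z < b + s + t" "b \<le> z" using that un by (auto simp: set_eq_iff)
      ultimately have "w \<in> S \<union> T" unfolding un using \<open>w \<in> {b..z}\<close> by auto
      then show "w \<in> S" using sep that \<open>w \<in> {b..z}\<close> by force
    qed
    from card_mono[OF fin this] show ?thesis using card by simp
  qed
  then have "S \<subseteq> {b..<b + s}" using un by auto
  then show S: "S = {b..<b + s}" using card by (intro card_subset_eq) auto
  have "S \<inter> T = {}" using sep by blast
  then have "T = {b..<b + s + t} - S" using un by blast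
  then show "T = {b + s..<b + s + t}" unfolding S by auto
qed

lemma set_seq_of_tree: "set (seq_of_tree a t) = {a..<a + size t}"
  by (induction t arbitrary: a) auto

lemma distinct_seq_of_tree: "distinct (seq_of_tree a t)"
  by (induction t arbitrary: a) (auto simp: set_seq_of_tree)

text \<open>The offset of the right subtree puts all its values above those of the left one, which
  is the separation that avoidance requires.\<close>

lemma avoids_213_seq_of_tree: "avoids_213 (seq_of_tree a t)"
proof (induction t arbitrary: a)
  case (Node l u r)
  then show ?case
    using distinct_seq_of_tree[of a "\<langle>l, u, r\<rangle>"]
    by (auto simp: avoids_213_append_Min_Cons ball_Un set_seq_of_tree)
qed simp

lemma tree_of_seq_seq_of_tree: "tree_of_seq (seq_of_tree a t) = t"
  by (induction t arbitrary: a) (auto simp: tree_of_seq_append_Min_Cons ball_Un set_seq_of_tree)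

text \<open>Besides counting leaves, this lets the decoder recover the length of \<open>x\<close>
  from the left subtree.\<close>

lemma size_tree_of_seq: "distinct p \<Longrightarrow> size (tree_of_seq p) = length p"
proof (induction p rule: length_induct)
  case (1 p)
  show ?case
  proof (cases "p = []")
    case False
    define m where "m = Min (set p)"
    have "m \<in> set p" using False by (simp add: m_def)
    then obtain y x where p: "p = y @ m # x" by (meson split_list)
    have "m \<le> z" if "z \<in> set p" for z using that by (simp add: m_def)
    then have "\<forall>z \<in> set y \<union> set x. m < z"
      using 1(2) by (force simp: p order_less_le)
    then show ?thesis
      using 1 by (simp add: p tree_of_seq_append_Min_Cons)
  qed simp
qed

text \<open>The start \<open>a\<close> is arbitrary because the induction passes to \<open>x\<close>
  and \<open>y\<close>, whose values fill intervals with other starting points.\<close>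

lemma seq_of_tree_tree_of_seq:
  assumes "set p = {a..<a + length p}" "distinct p" "avoids_213 p"
  shows "seq_of_tree a (tree_of_seq p) = p"
  using assms
proof (induction p arbitrary: a rule: length_induct)
  case (1 p)
  show ?case
  proof (cases "p = []")
    case False
    \<comment> \<open>The values of a nonempty \<open>p\<close> form an interval starting at
      \<open>a\<close>, so \<open>a\<close> is its minimum.\<close>
    then have "a \<in> set p" using 1(2) by simp
    then obtain y x where p: "p = y @ a # x" by (meson split_list)
    have min: "\<forall>z \<in> set y \<union> set x. a < z"
    proof
      fix z assume "z \<in> set y \<union> set x"
      then have "z \<in> set p" "z \<noteq> a" using 1(3) by (auto simp: p)
      then show "a < z" using 1(2) by simp
    qed
    have av: "avoids_213 y" "avoids_213 x" "\<forall>b \<in> set x. \<forall>c \<in> set y. b < c"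
      using avoids_213_append_Min_Cons[OF min] 1(3,4) by (simp_all add: p)
    have "set x \<union> set y = set p - {a}" using 1(3) by (auto simp: p)
    also have "\<dots> = {Suc a..<Suc a + length x + length y}" unfolding 1(2) by (auto simp: p)
    finally have un: "set x \<union> set y = {Suc a..<Suc a + length x + length y}" .
    have dist: "distinct x" "distinct y" using 1(3) by (auto simp: p)
    have sets: "set x = {Suc a..<Suc a + length x}"
      "set y = {Suc a + length x..<Suc a + length x + length y}"
      using Un_eq_atLeastLessThan_separated[OF un av(3)] dist by (simp_all add: distinct_card)
    have "seq_of_tree (Suc a) (tree_of_seq x) = x"
      using 1(1) sets(1) dist av by (simp add: p)
    moreover have "seq_of_tree (Suc a + length x) (tree_of_seq y) = y"
      using 1(1) sets(2) dist av by (simp add: p)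
    ultimately show ?thesis
      using dist by (simp add: p tree_of_seq_append_Min_Cons[OF min] size_tree_of_seq)
  qed simp
qed

theorem mainTheorem8:
  fixes n :: nat
  assumes "n \<ge> 1"
  shows "bij_betw tree_of_seq
           {p \<in> permutations_of_set {1..n}. avoids_213 p}
           {t :: unit tree. size1 t = n + 1}"
\<comment> \<open>Decoding starts at 1, the least value of a permutation of
  \<open>{1..n}\<close>.\<close>
proof (rule bij_betw_byWitness[where f' = "seq_of_tree 1"])
  have interval: "{1..n} = {1..<1 + n}" by auto
  let ?P = "{p \<in> permutations_of_set {1..n}. avoids_213 p}"
  have length: "length p = n" if "p \<in> ?P" for p
    using that by (auto dest: length_finite_permutations_of_set)
  show "\<forall>p \<in> ?P. seq_of_tree 1 (tree_of_seq p) = p"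
    using length by (auto intro!: seq_of_tree_tree_of_seq simp: permutations_of_set_def interval)
  show "\<forall>t \<in> {t. size1 t = n + 1}. tree_of_seq (seq_of_tree 1 t) = t"
    by (simp add: tree_of_seq_seq_of_tree)
  show "tree_of_seq ` ?P \<subseteq> {t. size1 t = n + 1}"
    using length by (auto simp: size1_size size_tree_of_seq permutations_of_set_def)
  show "seq_of_tree 1 ` {t. size1 t = n + 1} \<subseteq> ?P"
    by (auto simp: size1_size permutations_of_set_def set_seq_of_tree distinct_seq_of_tree
        avoids_213_seq_of_tree)
qed

end
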